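(* For every $\alpha_0\in(-1,\infty)$, the constant $$B_{2,\alpha_0}:=\sup_{u\in X^{1,2}_\infty(\alpha_0,1)\setminus\{0\}}\frac{\|u\|^4_{L^4_{\alpha_0}}}{\|u'\|^2_{L^2_1}\|u\|^2_{L^2_{\alpha_0}}}$$ satisfies $$B_{2,\alpha_0}\ge\frac{4}{(\alpha_0+1)\,e\log2}.$$ In particular, $B_{2,\alpha_0}>2/(\alpha_0+1)$.
   Context: For $q\ge1$ and $\theta\in\mathbb R$, $L^q_\theta=L^q_\theta(0,\infty)$ is the space of measurable $u:(0,\infty)\to\mathbb R$ with $\|u\|_{L^q_\theta}=\left(\int_0^\infty|u|^q r^\theta\,dr\right)^{1/q}<\infty$. $X^{1,2}_\infty(\alpha_0,1)$ is the space of functions $u:(0,\infty)\to\mathbb R$ with $u\in L^2_{\alpha_0}$ and weak derivative $u'\in L^2_1$. $\log$ is the natural logarithm. *)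

theory Defs
  imports "HOL-Analysis.Analysis"
begin

text \<open>
  Functions on the half-line (0, \<infinity>) are modelled as \<^typ>\<open>real \<Rightarrow> real\<close>; only their values
  on \<^term>\<open>{0::real<..}\<close> matter. Measurability is with respect to the Lebesgue measure on that set.
\<close>

abbreviation half_line :: "real measure" where
  "half_line \<equiv> lebesgue_on {0<..}"

definition weighted_norm :: "real \<Rightarrow> real \<Rightarrow> (real \<Rightarrow> real) \<Rightarrow> ennreal" where
  "weighted_norm q \<theta> u =
     (let I = (\<integral>\<^sup>+ r. ennreal (\<bar>u r\<bar> powr q * r powr \<theta>) \<partial>half_line)
      in if I = \<infinity> then \<infinity> else ennreal (enn2real I powr (1 / q)))"

definition weighted_L :: "real \<Rightarrow> real \<Rightarrow> (real \<Rightarrow> real) set" where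
  "weighted_L q \<theta> = {u. u \<in> borel_measurable half_line \<and> weighted_norm q \<theta> u < \<infinity>}"

definition test_function :: "(real \<Rightarrow> real) \<Rightarrow> bool" where
  "test_function \<phi> \<longleftrightarrow>
     (\<forall>k x. (deriv ^^ k) \<phi> differentiable (at x)) \<and>
     compact (closure {x. \<phi> x \<noteq> 0}) \<and> closure {x. \<phi> x \<noteq> 0} \<subseteq> {0<..}"

definition locally_integrable :: "(real \<Rightarrow> real) \<Rightarrow> bool" where
  "locally_integrable u \<longleftrightarrow> (\<forall>K. compact K \<and> K \<subseteq> {0<..} \<longrightarrow> integrable (lebesgue_on K) u)"

definition weak_derivative :: "(real \<Rightarrow> real) \<Rightarrow> (real \<Rightarrow> real) \<Rightarrow> bool" where
  "weak_derivative u v \<longleftrightarrow>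
     locally_integrable u \<and> locally_integrable v \<and>
     (\<forall>\<phi>. test_function \<phi> \<longrightarrow>
        (LINT r|half_line. u r * deriv \<phi> r) = - (LINT r|half_line. v r * \<phi> r))"

definition X12 :: "real \<Rightarrow> real \<Rightarrow> (real \<Rightarrow> real) set" where
  "X12 \<alpha>0 \<alpha>1 =
     {u. u \<in> weighted_L 2 \<alpha>0 \<and> (\<exists>u'. weak_derivative u u' \<and> u' \<in> weighted_L 2 \<alpha>1)}"

text \<open>
  The supremum is taken in \<^typ>\<open>ennreal\<close>, so no finiteness is presupposed. Elements of the space
  are functions up to equality almost everywhere, hence \<open>u \<noteq> 0\<close> is read almost everywhere. The
  weak derivative is unique up to null sets, so the quotient does not depend on the choice of
  \<open>u'\<close>. The denominator is positive: a \<open>u\<close> with \<open>u' = 0\<close> is almost everywhere constant, and for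
  \<open>\<alpha>0 > -1\<close> the only constant in the space is zero.
\<close>

definition B2 :: "real \<Rightarrow> ennreal" where
  "B2 \<alpha>0 =
     Sup {weighted_norm 4 \<alpha>0 u ^ 4 / (weighted_norm 2 1 u' ^ 2 * weighted_norm 2 \<alpha>0 u ^ 2) | u u'.
            u \<in> X12 \<alpha>0 1 \<and> \<not> (AE r in half_line. u r = 0) \<and> weak_derivative u u'}"

end

theory Submission
  imports Defs "HOL-Real_Asymp.Real_Asymp"
begin

text \<open>
  With \<open>b = \<alpha>0 + 1\<close>, test the quotient on \<open>u r = (1 + r powr b) powr -2\<close>. The substitution
  \<open>s = r powr b\<close> turns the three integrals into rational ones, with values \<open>1 / (7 b)\<close> for
  \<open>u ^ 4\<close>, \<open>1 / (3 b)\<close> for \<open>u ^ 2\<close> and \<open>b / 5\<close> for the energy, so the quotient is \<open>15 / (7 b)\<close>.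
  This exceeds \<open>2 / b\<close>, and it is at least \<open>4 / (b e ln 2)\<close> because \<open>e ln 2 \<approx> 1.884 \<ge> 28 / 15\<close>.
  Among the profiles \<open>(1 + s) powr -p\<close>, the quotient \<open>(4 p\<^sup>2 - 1) / (4 p\<^sup>2 - p)\<close> (in units of \<open>2 / b\<close>)
  is nearly maximal at \<open>p = 2\<close>.
\<close>

section \<open>Weak derivatives of continuously differentiable functions\<close>

lemma integrable_lebesgue_on_compact:
  fixes f :: "real \<Rightarrow> real"
  assumes "compact K" "continuous_on K f"
  shows "integrable (lebesgue_on K) f"
proof -
  have "integrable lborel (\<lambda>x. indicator K x *\<^sub>R f x)"
    by (rule borel_integrable_compact[OF assms])
  then have "integrable lebesgue (\<lambda>x. indicator K x *\<^sub>R f x)"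
    by (subst integrable_completion) auto
  then show ?thesis
    using assms(1) by (subst integrable_restrict_space) (auto intro!: lmeasurable_compact fmeasurableD)
qed

text \<open>Integration by parts: a test function vanishes near 0 and near infinity, so integrating
  the derivative of \<open>u * \<phi>\<close> over an interval around the support leaves no boundary
  term. Continuity of \<open>u\<close> and \<open>u'\<close> gives local integrability.\<close>

lemma weak_derivativeI:
  assumes deriv: "\<And>x. 0 < x \<Longrightarrow> (u has_real_derivative u' x) (at x)"
    and cont: "continuous_on {0<..} u'"
  shows "weak_derivative u u'"
  unfolding weak_derivative_def locally_integrable_def
proof (intro conjI allI impI; (elim conjE)?)
  have cont_u: "continuous_on {0<..} u"
    using deriv by (auto intro!: continuous_at_imp_continuous_on DERIV_isCont)
  fix K :: "real set" assume K: "compact K" "K \<subseteq> {0<..}"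
  show "integrable (lebesgue_on K) u" "integrable (lebesgue_on K) u'"
    using K cont cont_u by (auto intro!: integrable_lebesgue_on_compact intro: continuous_on_subset)
next
  have cont_u: "continuous_on {0<..} u"
    using deriv by (auto intro!: continuous_at_imp_continuous_on DERIV_isCont)
  fix \<phi> assume "test_function \<phi>"
  define K where "K = closure {x. \<phi> x \<noteq> 0}"
  have smooth: "(deriv ^^ k) \<phi> differentiable (at x)" for k x
    using \<open>test_function \<phi>\<close> by (auto simp: test_function_def)
  have K: "compact K" "K \<subseteq> {0<..}"
    using \<open>test_function \<phi>\<close> by (auto simp: test_function_def K_def)
  have \<phi>': "(\<phi> has_real_derivative deriv \<phi> x) (at x)" for x
    using smooth[of 0 x] by (simp add: DERIV_deriv_iff_real_differentiable)
  have cont_\<phi>: "continuous_on A \<phi>" for A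
    using \<phi>' by (auto intro!: continuous_at_imp_continuous_on DERIV_isCont)
  have cont_\<phi>': "continuous_on A (deriv \<phi>)" for A
    using smooth[of 1] by (auto intro!: continuous_at_imp_continuous_on differentiable_imp_continuous_within)
  have \<phi>_out: "\<phi> x = 0" if "x \<notin> K" for x
    using that closure_subset[of "{x. \<phi> x \<noteq> 0}"] by (auto simp: K_def)
  \<comment> \<open>\<open>K\<close> is closed, so \<open>\<phi>\<close> is identically zero in a
    neighbourhood of \<open>x\<close>.\<close>
  have \<phi>'_out: "deriv \<phi> x = 0" if "x \<notin> K" for x
  proof -
    have "open (- K)" using K by (simp add: compact_imp_closed open_Compl)
    then have "(\<phi> has_real_derivative 0) (at x)"
      using that \<phi>_out
      by (intro has_field_derivative_transform_within_open[OF DERIV_const[of 0], where S = "- K"]) auto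
    then show ?thesis by (rule DERIV_imp_deriv)
  qed
  \<comment> \<open>The enclosing interval is open so that \<open>a\<close> and \<open>b\<close> lie
    outside \<open>K\<close>, where \<open>\<phi>\<close> vanishes. An empty support has no extremal
    points and gets a dummy interval.\<close>
  obtain a b where ab: "0 < a" "a \<le> b" "K \<subseteq> {a<..<b}"
  proof (cases "K = {}")
    case True
    then show ?thesis using that[of 1 1] by auto
  next
    case False
    obtain m where m: "m \<in> K" "\<And>x. x \<in> K \<Longrightarrow> m \<le> x"
      using compact_attains_inf[OF K(1) False] by auto
    obtain M where M: "M \<in> K" "\<And>x. x \<in> K \<Longrightarrow> x \<le> M"
      using compact_attains_sup[OF K(1) False] by auto
    have "0 < m" using m K by auto
    show ?thesis
    proof (rule that[of "m / 2" "M + 1"])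
      show "K \<subseteq> {m / 2<..<M + 1}" using m(2) M(2) \<open>0 < m\<close> by (force simp: field_simps)
      show "m / 2 \<le> M + 1" using m(2)[OF M(1)] \<open>0 < m\<close> by simp
    qed (use \<open>0 < m\<close> in auto)
  qed
  have sub: "{a..b} \<subseteq> {0<..}" using ab by auto
  \<comment> \<open>Passes from the Lebesgue integral to the gauge integral on
    \<open>{a..b}\<close>, for which the fundamental theorem of calculus is stated.\<close>
  have reduce: "(LINT r|half_line. f r) = integral {a..b} f"
    if out: "\<And>x. x \<notin> K \<Longrightarrow> f x = 0" and c: "continuous_on {a..b} f" for f :: "real \<Rightarrow> real"
  proof -
    have "(LINT r|half_line. f r) = (LINT r|lebesgue. indicator {0<..} r *\<^sub>R f r)"
      by (subst integral_restrict_space) auto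
    also have "\<dots> = (LINT r|lebesgue. indicator {a..b} r *\<^sub>R f r)"
    proof (intro Bochner_Integration.integral_cong refl)
      show "indicator {0<..} r *\<^sub>R f r = indicator {a..b} r *\<^sub>R f r" for r
        using sub ab(3) out[of r] by (cases "r \<in> K") (auto simp: indicator_def)
    qed
    also have "\<dots> = (LINT r|lebesgue_on {a..b}. f r)"
      by (subst integral_restrict_space) auto
    also have "\<dots> = integral {a..b} f"
      by (intro lebesgue_integral_eq_integral continuous_imp_integrable_real c) auto
    finally show ?thesis .
  qed
  have c1: "continuous_on {a..b} (\<lambda>r. u r * deriv \<phi> r)"
    and c2: "continuous_on {a..b} (\<lambda>r. u' r * \<phi> r)"
    using cont cont_u sub cont_\<phi> cont_\<phi>'
    by (auto intro!: continuous_intros intro: continuous_on_subset)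
  have "((\<lambda>r. u r * deriv \<phi> r + u' r * \<phi> r) has_integral u b * \<phi> b - u a * \<phi> a) {a..b}"
  proof (rule fundamental_theorem_of_calculus[OF ab(2)])
    fix x assume "x \<in> {a..b}"
    then have "((\<lambda>r. u r * \<phi> r) has_real_derivative u x * deriv \<phi> x + u' x * \<phi> x) (at x)"
      using sub by (auto intro!: derivative_eq_intros deriv \<phi>')
    then show "((\<lambda>r. u r * \<phi> r) has_vector_derivative u x * deriv \<phi> x + u' x * \<phi> x) (at x within {a..b})"
      by (auto simp: has_real_derivative_iff_has_vector_derivative intro: has_vector_derivative_at_within)
  qed
  moreover have "\<phi> a = 0" "\<phi> b = 0" using ab(3) by (auto intro!: \<phi>_out)
  ultimately have "integral {a..b} (\<lambda>r. u r * deriv \<phi> r + u' r * \<phi> r) = 0"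
    by (simp add: integral_unique)
  moreover have "integral {a..b} (\<lambda>r. u r * deriv \<phi> r + u' r * \<phi> r)
      = integral {a..b} (\<lambda>r. u r * deriv \<phi> r) + integral {a..b} (\<lambda>r. u' r * \<phi> r)"
    by (intro integral_add integrable_continuous_real c1 c2)
  ultimately show "(LINT r|half_line. u r * deriv \<phi> r) = - (LINT r|half_line. u' r * \<phi> r)"
    using c1 c2 \<phi>_out \<phi>'_out by (simp add: reduce)
qed

section \<open>Integrals over the half-line by antiderivatives, and their link to the norms\<close>

lemma nn_integral_half_line_FTC:
  assumes F: "\<And>x. 0 < x \<Longrightarrow> (F has_real_derivative f x) (at x)"
    and cont: "continuous_on {0<..} f"
    and nonneg: "\<And>x. 0 < x \<Longrightarrow> 0 \<le> f x"
    and A: "(F \<longlongrightarrow> A) (at_right 0)" and B: "(F \<longlongrightarrow> B) at_top"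
  shows "(\<integral>\<^sup>+ r. ennreal (f r) \<partial>half_line) = ennreal (B - A)"
proof -
  have isc: "isCont f x" if "0 < x" for x
    using cont that by (simp add: continuous_on_eq_continuous_at)
  have A': "((F \<circ> real_of_ereal) \<longlongrightarrow> A) (at_right (ereal 0))"
    and B': "((F \<circ> real_of_ereal) \<longlongrightarrow> B) (at_left \<infinity>)"
    using A B by (simp_all add: ereal_tendsto_simps)
  have "AE x in lborel. ereal 0 < ereal x \<longrightarrow> ereal x < \<infinity> \<longrightarrow> 0 \<le> f x"
    using nonneg by simp
  \<comment> \<open>Nonnegativity makes the improper fundamental theorem yield integrability along
    with the value. Only one-sided limits of \<open>F\<close> enter, so \<open>f\<close> may be
    singular at 0, as happens below for small \<open>b\<close>.\<close>
  note FTC = interval_integral_FTC_nonneg[OF _ _ _ this A' B']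
  have int: "set_integrable lborel (einterval 0 \<infinity>) f" and eq: "(LBINT x=0..\<infinity>. f x) = B - A"
    using FTC F isc by (simp_all add: zero_ereal_def)
  have ein: "einterval 0 \<infinity> = {0<..}" by (auto simp: einterval_def)
  have "(\<integral>\<^sup>+ r. ennreal (f r) \<partial>half_line) = (\<integral>\<^sup>+ r. ennreal (f r) * indicator {0<..} r \<partial>lborel)"
    by (subst nn_integral_restrict_space) (auto simp: nn_integral_completion)
  also have "\<dots> = (\<integral>\<^sup>+ r. ennreal (indicator {0<..} r *\<^sub>R f r) \<partial>lborel)"
    by (intro nn_integral_cong) (auto simp: indicator_def)
  also have "\<dots> = ennreal (LINT r|lborel. indicator {0<..} r *\<^sub>R f r)"
    using int nonneg by (intro nn_integral_eq_integral) (auto simp: set_integrable_def ein indicator_def)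
  also have "(LINT r|lborel. indicator {0<..} r *\<^sub>R f r) = B - A"
    using eq by (simp add: interval_lebesgue_integral_def set_lebesgue_integral_def ein)
  finally show ?thesis .
qed

text \<open>The change of variables \<open>s = r powr b\<close> is done on the antiderivative: by
  the chain rule \<open>G (r powr b) / b\<close> differentiates to the integrand. Differentiability
  of \<open>G\<close> at 0 provides the continuity that identifies the limit there.\<close>

lemma nn_integral_half_line_powr_substitution:
  assumes b: "0 < b"
    and G: "\<And>s. 0 \<le> s \<Longrightarrow> (G has_real_derivative g s) (at s)"
    and cont: "continuous_on {0<..} g"
    and nonneg: "\<And>s. 0 < s \<Longrightarrow> 0 \<le> g s"
    and L: "(G \<longlongrightarrow> L) at_top"
  shows "(\<integral>\<^sup>+ r. ennreal (g (r powr b) * r powr (b - 1)) \<partial>half_line) = ennreal ((L - G 0) / b)"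
proof -
  have top: "filterlim (\<lambda>r. r powr b) at_top at_top" using b by real_asymp
  have zero: "((\<lambda>r. r powr b) \<longlongrightarrow> 0) (at_right 0)" using b by real_asymp
  have "isCont G 0" using G[of 0] by (simp add: DERIV_isCont)
  then have G0: "((\<lambda>r. G (r powr b)) \<longlongrightarrow> G 0) (at_right 0)"
    using zero by (rule isCont_tendsto_compose)
  have "(\<integral>\<^sup>+ r. ennreal (g (r powr b) * r powr (b - 1)) \<partial>half_line) = ennreal (L / b - G 0 / b)"
  proof (rule nn_integral_half_line_FTC[where F = "\<lambda>r. G (r powr b) / b"])
    fix x :: real assume x: "0 < x"
    have "((\<lambda>r. r powr b) has_real_derivative b * x powr (b - 1)) (at x)"
      using x by (rule has_real_derivative_powr)
    from DERIV_cdivide[OF DERIV_chain2[OF G this], of b]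
    show "((\<lambda>r. G (r powr b) / b) has_real_derivative g (x powr b) * x powr (b - 1)) (at x)"
      using b by simp
    show "0 \<le> g (x powr b) * x powr (b - 1)" using x by (simp add: nonneg)
  next
    show "continuous_on {0<..} (\<lambda>r. g (r powr b) * r powr (b - 1))"
      by (intro continuous_intros continuous_on_compose2[OF cont]) auto
  qed (use b in \<open>auto intro!: tendsto_intros G0 filterlim_compose[OF L top]\<close>)
  then show ?thesis by (simp add: diff_divide_distrib)
qed

text \<open>Each norm enters the quotient to the power of its own exponent, so the root cancels and
  only the integral remains.\<close>

lemma weighted_norm_power:
  assumes "(\<integral>\<^sup>+ r. ennreal (\<bar>u r\<bar> powr real n * r powr \<theta>) \<partial>half_line) = ennreal c" "0 < c" "0 < n"
  shows "weighted_norm (real n) \<theta> u ^ n = ennreal c" "weighted_norm (real n) \<theta> u < \<infinity>"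
  using assms by (simp_all add: weighted_norm_def ennreal_power powr_power)

text \<open>The threshold 28/15 is 4 / (15/7): it is what makes the test quotient 15/7 at least 4 /
  (e ln 2).\<close>

lemma exp_1_times_ln_2_ge: "28 / 15 \<le> exp 1 * ln (2::real)"
proof -
  have "(\<Sum>k<5. inverse (fact k)) \<le> exp (1::real)"
    using sum_le_suminf[OF summable_exp, of "{..<5}" "1::real"] by (simp add: exp_def)
  then have "27 / 10 \<le> exp (1::real)" by (simp add: eval_nat_numeral)
  \<comment> \<open>Little room is left: 2.7 * 0.69 = 1.863 falls short of 28/15 = 1.8667, while 2.7
    * 0.692 = 1.8684 suffices.\<close>
  moreover have "69 / 100 + 1 / 500 \<le> ln (2::real)"
    using ln_approx_bounds[of 2 3] by (simp add: eval_nat_numeral)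
  ultimately have "(27 / 10) * (69 / 100 + 1 / 500) \<le> exp 1 * ln (2::real)"
    by (intro mult_mono) auto
  then show ?thesis by simp
qed

section \<open>The test function and its three integrals\<close>

definition bubble :: "real \<Rightarrow> real \<Rightarrow> real" where
  "bubble b r = 1 / (1 + r powr b) ^ 2"

definition bubble' :: "real \<Rightarrow> real \<Rightarrow> real" where
  "bubble' b r = - 2 * b * r powr (b - 1) / (1 + r powr b) ^ 3"

lemma one_plus_powr_pos [simp]: "0 < 1 + r powr b" for r b :: real
  by (simp add: add_pos_nonneg)

lemma one_plus_powr_nonzero [simp]: "1 + r powr b \<noteq> 0" for r b :: real
  using one_plus_powr_pos[of r b] by linarith

lemma bubble_has_derivative:
  "0 < r \<Longrightarrow> (bubble b has_real_derivative bubble' b r) (at r)"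
  unfolding bubble_def bubble'_def
  by (auto intro!: derivative_eq_intros simp: divide_simps) (simp add: eval_nat_numeral algebra_simps)

lemma continuous_on_bubble: "continuous_on {0<..} (bubble b)" "continuous_on {0<..} (bubble' b)"
  unfolding bubble_def bubble'_def by (auto intro!: continuous_intros)

lemma bubble_integral:
  assumes "0 < b" "0 < n"
  shows "(\<integral>\<^sup>+ r. ennreal (\<bar>bubble b r\<bar> powr real n * r powr (b - 1)) \<partial>half_line)
    = ennreal (1 / (real (2 * n - 1) * b))"
proof -
  \<comment> \<open>The integrand becomes \<open>(1 + s)\<close> to the power -2n, and
    \<open>m\<close> is the exponent in its antiderivative. Writing 2n as \<open>Suc m\<close>
    avoids truncated subtraction.\<close>
  define m where "m = 2 * n - 1"
  have m: "0 < m" "2 * n = Suc m" using assms by (auto simp: m_def)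
  have "(\<integral>\<^sup>+ r. ennreal (1 / (1 + r powr b) ^ Suc m * r powr (b - 1)) \<partial>half_line)
    = ennreal ((0 - (- 1 / (real m * (1 + 0) ^ m))) / b)"
  proof (rule nn_integral_half_line_powr_substitution[OF assms(1)])
    show "((\<lambda>s. - 1 / (real m * (1 + s) ^ m)) \<longlongrightarrow> 0) at_top"
      using m(1) by real_asymp
    show "((\<lambda>s. - 1 / (real m * (1 + s) ^ m)) has_real_derivative 1 / (1 + s) ^ Suc m) (at s)"
      if "0 \<le> s" for s
    proof -
      obtain k where k: "m = Suc k" using m(1) gr0_implies_Suc by blast
      have "1 + s \<noteq> 0" using that by simp
      then show ?thesis
        unfolding k by (auto intro!: derivative_eq_intros simp: divide_simps simp del: of_nat_Suc)
          (cases k, auto simp: algebra_simps)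
    qed
  qed (auto intro!: continuous_intros simp: add_nonneg_eq_0_iff)
  also have "(\<integral>\<^sup>+ r. ennreal (1 / (1 + r powr b) ^ Suc m * r powr (b - 1)) \<partial>half_line)
      = (\<integral>\<^sup>+ r. ennreal (\<bar>bubble b r\<bar> powr real n * r powr (b - 1)) \<partial>half_line)"
  proof (intro nn_integral_cong arg_cong[of _ _ ennreal])
    fix r :: real
    have "0 < bubble b r" by (simp add: bubble_def)
    then have "\<bar>bubble b r\<bar> powr real n = bubble b r ^ n" by (simp add: powr_realpow)
    also have "\<dots> = 1 / (1 + r powr b) ^ Suc m"
      unfolding bubble_def m(2)[symmetric] power_mult by (rule power_one_over)
    finally show "1 / (1 + r powr b) ^ Suc m * r powr (b - 1)
        = \<bar>bubble b r\<bar> powr real n * r powr (b - 1)" by simp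
  qed
  finally show ?thesis by (simp add: m_def)
qed

text \<open>In the energy density the weight \<open>r\<close> turns one factor
  \<open>r powr (b - 1)\<close> into \<open>r powr b\<close>; the other is the Jacobian of the
  substitution. What remains is the integral of s / (1 + s)^6, equal to 1/20.\<close>

lemma bubble'_integral:
  assumes "0 < b"
  shows "(\<integral>\<^sup>+ r. ennreal (\<bar>bubble' b r\<bar> powr real 2 * r powr 1) \<partial>half_line) = ennreal (b / 5)"
proof -
  \<comment> \<open>Found by writing s as (1 + s) - 1 and integrating the two powers of 1 + s
    separately.\<close>
  let ?G = "\<lambda>s. - (b\<^sup>2 * (1 + 5 * s)) / (5 * (1 + s) ^ 5)"
  have "(\<integral>\<^sup>+ r. ennreal ((4 * b\<^sup>2 * (r powr b / (1 + r powr b) ^ 6)) * r powr (b - 1)) \<partial>half_line)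
    = ennreal ((0 - ?G 0) / b)"
  proof (rule nn_integral_half_line_powr_substitution[OF assms])
    show "(?G \<longlongrightarrow> 0) at_top" by real_asymp
    show "(?G has_real_derivative 4 * b\<^sup>2 * (s / (1 + s) ^ 6)) (at s)" if "0 \<le> s" for s
    proof -
      have nz: "1 + s \<noteq> 0" using that by simp
      then have "(?G has_real_derivative
          (- (b\<^sup>2 * 5) * (5 * (1 + s) ^ 5) + b\<^sup>2 * (1 + 5 * s) * (25 * (1 + s) ^ 4))
            / (5 * (1 + s) ^ 5)\<^sup>2) (at s)"
        by (auto intro!: derivative_eq_intros simp: power2_eq_square) (simp add: diff_divide_distrib)
      also have "- (b\<^sup>2 * 5) * (5 * (1 + s) ^ 5) + b\<^sup>2 * (1 + 5 * s) * (25 * (1 + s) ^ 4)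
          = (25 * (1 + s) ^ 4) * (4 * b\<^sup>2 * s)"
        by (simp add: eval_nat_numeral algebra_simps)
      also have "(5 * (1 + s) ^ 5)\<^sup>2 = (25 * (1 + s) ^ 4) * (1 + s) ^ 6"
        by (simp add: power_mult_distrib flip: power_mult power_add)
      also have "(25 * (1 + s) ^ 4) * (4 * b\<^sup>2 * s) / ((25 * (1 + s) ^ 4) * (1 + s) ^ 6)
          = 4 * b\<^sup>2 * (s / (1 + s) ^ 6)"
        using nz by simp
      finally show ?thesis .
    qed
  qed (auto intro!: continuous_intros simp: add_nonneg_eq_0_iff)
  also have "(\<integral>\<^sup>+ r. ennreal ((4 * b\<^sup>2 * (r powr b / (1 + r powr b) ^ 6)) * r powr (b - 1)) \<partial>half_line)
      = (\<integral>\<^sup>+ r. ennreal (\<bar>bubble' b r\<bar> powr real 2 * r powr 1) \<partial>half_line)"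
  proof (intro nn_integral_cong arg_cong[of _ _ ennreal])
    fix r assume "r \<in> space half_line"
    then have r: "0 < r" by (simp add: space_restrict_space)
    have "\<bar>bubble' b r\<bar> powr real 2 = (bubble' b r)\<^sup>2" by simp
    also have "\<dots> = 4 * b\<^sup>2 * (r powr (b - 1) * r powr (b - 1)) / (1 + r powr b) ^ 6"
      by (simp add: bubble'_def power_divide power_mult_distrib power2_eq_square flip: power_mult power_add)
    finally have "\<bar>bubble' b r\<bar> powr real 2 * r powr 1
        = 4 * b\<^sup>2 * (r powr (b - 1) * r powr 1 * r powr (b - 1)) / (1 + r powr b) ^ 6"
      by (simp add: mult_ac)
    also have "r powr (b - 1) * r powr 1 = r powr b"
      using powr_add[of r "b - 1" 1] by simp
    finally show "4 * b\<^sup>2 * (r powr b / (1 + r powr b) ^ 6) * r powr (b - 1)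
        = \<bar>bubble' b r\<bar> powr real 2 * r powr 1" by simp
  qed
  finally show ?thesis using assms by (simp add: power2_eq_square field_simps)
qed

section \<open>The quotient of the test function and the two bounds\<close>

lemma B2_ge:
  assumes "-1 < \<alpha>0"
  shows "ennreal (15 / (7 * (\<alpha>0 + 1))) \<le> B2 \<alpha>0"
proof -
  define b where "b = \<alpha>0 + 1"
  have b: "0 < b" and \<alpha>0: "\<alpha>0 = b - 1" using assms by (auto simp: b_def)
  have I4: "(\<integral>\<^sup>+ r. ennreal (\<bar>bubble b r\<bar> powr real 4 * r powr \<alpha>0) \<partial>half_line) = ennreal (1 / (7 * b))"
    and I2: "(\<integral>\<^sup>+ r. ennreal (\<bar>bubble b r\<bar> powr real 2 * r powr \<alpha>0) \<partial>half_line) = ennreal (1 / (3 * b))"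
    using bubble_integral[OF b, of 4] bubble_integral[OF b, of 2] by (simp_all add: \<alpha>0)
  note N4 = weighted_norm_power[OF I4, simplified, OF b] and N2 = weighted_norm_power[OF I2, simplified, OF b]
    and N' = weighted_norm_power[OF bubble'_integral[OF b], simplified, OF b]
  have meas: "bubble b \<in> borel_measurable half_line" "bubble' b \<in> borel_measurable half_line"
    by (auto intro!: continuous_imp_measurable_on_sets_lebesgue continuous_on_bubble)
  have weak: "weak_derivative (bubble b) (bubble' b)"
    by (intro weak_derivativeI bubble_has_derivative continuous_on_bubble)
  have mem: "bubble b \<in> X12 \<alpha>0 1"
    using weak meas b N2 N' by (auto simp: X12_def weighted_L_def)
  have nonzero: "\<not> (AE r in half_line. bubble b r = 0)"
  proof
    assume "AE r in half_line. bubble b r = 0"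
    then have "(\<integral>\<^sup>+ r. ennreal (\<bar>bubble b r\<bar> powr real 2 * r powr \<alpha>0) \<partial>half_line)
        = (\<integral>\<^sup>+ r. 0 \<partial>half_line)"
      by (intro nn_integral_cong_AE) (auto elim!: eventually_mono)
    with I2 b show False by simp
  qed
  \<comment> \<open>The denominator is first merged into a single positive real, so that the
    \<open>ennreal\<close> division becomes a real one.\<close>
  have "weighted_norm 4 \<alpha>0 (bubble b) ^ 4 /
      (weighted_norm 2 1 (bubble' b) ^ 2 * weighted_norm 2 \<alpha>0 (bubble b) ^ 2)
    = ennreal (1 / (7 * b)) / ennreal (b / 5 * (1 / (3 * b)))"
    unfolding N4(1) N2(1) N'(1) using b by (subst ennreal_mult) simp_all
  also have "\<dots> = ennreal (15 / (7 * b))"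
    using b by (subst divide_ennreal) (auto simp: field_simps)
  finally have "ennreal (15 / (7 * b)) = weighted_norm 4 \<alpha>0 (bubble b) ^ 4 /
      (weighted_norm 2 1 (bubble' b) ^ 2 * weighted_norm 2 \<alpha>0 (bubble b) ^ 2)" by simp
  then show ?thesis
    unfolding B2_def b_def[symmetric] using mem nonzero weak by (intro Sup_upper) blast
qed

theorem lemma3p3:
  fixes \<alpha>0 :: real
  assumes "-1 < \<alpha>0"
  shows "B2 \<alpha>0 \<ge> ennreal (4 / ((\<alpha>0 + 1) * exp 1 * ln 2)) \<and> B2 \<alpha>0 > ennreal (2 / (\<alpha>0 + 1))"
proof
  have pos: "0 < \<alpha>0 + 1" using assms by simp
  have "4 / (exp 1 * ln 2) \<le> 4 / (28 / 15 :: real)"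
    by (intro divide_left_mono exp_1_times_ln_2_ge) auto
  then have "4 / (exp 1 * ln 2) / (\<alpha>0 + 1) \<le> 15 / 7 / (\<alpha>0 + 1)"
    using pos by (intro divide_right_mono) auto
  then have "4 / ((\<alpha>0 + 1) * exp 1 * ln 2) \<le> 15 / (7 * (\<alpha>0 + 1))"
    by (simp add: mult_ac)
  then show "ennreal (4 / ((\<alpha>0 + 1) * exp 1 * ln 2)) \<le> B2 \<alpha>0"
    using B2_ge[OF assms] by (meson ennreal_leI order_trans)
  \<comment> \<open>Strictness comes straight from the test function, since 15/7 > 2.\<close>
  have "2 / (\<alpha>0 + 1) < 15 / (7 * (\<alpha>0 + 1))" using pos by (simp add: field_simps)
  then have "ennreal (2 / (\<alpha>0 + 1)) < ennreal (15 / (7 * (\<alpha>0 + 1)))"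
    using pos by (intro ennreal_lessI) auto
  then show "ennreal (2 / (\<alpha>0 + 1)) < B2 \<alpha>0"
    using B2_ge[OF assms] by (rule less_le_trans)
qed

end
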